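(* Let $(X,Y,\langle\cdot,\cdot\rangle)$ be a dual system and let $n\in\{1,2,\dots\}\cup\{\infty\}$. An operator $T:X\rightrightarrows Y$ is $n$-monotone if and only if $P_T^{\langle n\rangle}\ge c$ on $X\times Y$. In this case $\operatorname{Graph}T\subset[P_T^{\langle n\rangle}=c]$ and, whenever $\operatorname{Graph}T\ne\emptyset$, $P_T^{\langle n\rangle}$ is proper.
   Context: All vector spaces are real. A dual system $(X,Y,\langle\cdot,\cdot\rangle)$ consists of vector spaces $X,Y$ and a bilinear map $c=\langle\cdot,\cdot\rangle:X\times Y\to\mathbb{R}$, $c(x,y)=\langle x,y\rangle$. $T:X\rightrightarrows Y$ is a multifunction with $\operatorname{Graph}T=\{(x,y)\mid y\in T(x)\}$ and inverse $T^{-1}(y)=\{x\mid y\in T(x)\}$. For finite $n$, $T$ is $n$-monotone if $\sum_{i=1}^n\langle x_i-x_{i+1},y_i\rangle\ge0$ for all $(x_1,y_1),\dots,(x_n,y_n)\in\operatorname{Graph}T$, with $x_{n+1}=x_1$; $T$ is $\infty$-monotone (cyclically monotone) if it is $k$-monotone for every integer $k\ge2$ (every operator is $1$-monotone). $[f=g]=\{z\mid f(z)=g(z)\}$. A function is proper if it is not identically $+\infty$ and never takes the value $-\infty$. Convention: $\inf\emptyset=+\infty$. The functions $P_T^{\langle n\rangle}:X\times Y\to\overline{\mathbb R}$ are: $P_T^{\langle1\rangle}=c_T$, where $c_T=c$ on $\operatorname{Graph}T$ and $+\infty$ elsewhere; $P_T^{\langle2\rangle}(x,y)=\inf\{\langle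 x_1,y\rangle+\langle x-x_1,y_2\rangle\mid x_1\in T^{-1}(y),\,y_2\in T(x)\}$; for $3\le n<\infty$, $P_T^{\langle n\rangle}(x,y)=\inf\{\langle x_1,y\rangle+\sum_{i=2}^{n-1}\langle x_i-x_{i-1},y_i\rangle+\langle x-x_{n-1},y_n\rangle\mid x_1\in T^{-1}(y),\,y_n\in T(x),\,(x_i,y_i)\in\operatorname{Graph}T\ (2\le i\le n-1)\}$; and $P_T^{\langle\infty\rangle}=\inf_{n\ge1}P_T^{\langle n\rangle}$. *)

theory Defs
  imports "HOL-Analysis.Analysis" "HOL-Library.Extended_Nat"
begin

text \<open>A dual system is given by two types of class \<open>real_vector\<close> and a coupling
  \<open>c\<close> with \<open>bilinear c\<close>; no separation or topology is required.
  A multifunction from \<open>X\<close> to \<open>Y\<close> is a set-valued function.\<close>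

definition mgraph :: "('a \<Rightarrow> 'b set) \<Rightarrow> ('a \<times> 'b) set" where
  "mgraph T = {(x, y). y \<in> T x}"

definition minverse :: "('a \<Rightarrow> 'b set) \<Rightarrow> 'b \<Rightarrow> 'a set" where
  "minverse T y = {x. y \<in> T x}"

text \<open>Families are functions on \<open>nat\<close> of which only the values at \<open>1, \<dots>, n\<close> matter;
  the conditional implements the cyclic convention \<open>x (n + 1) = x 1\<close>.\<close>

definition fin_monotone ::
  "('a::real_vector \<Rightarrow> 'b::real_vector \<Rightarrow> real) \<Rightarrow> nat \<Rightarrow> ('a \<Rightarrow> 'b set) \<Rightarrow> bool" where
  "fin_monotone c n T \<longleftrightarrow>
     (\<forall>x y. (\<forall>i\<in>{1..n}. (x i, y i) \<in> mgraph T) \<longrightarrow>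
        (\<Sum>i=1..n. c (x i - x (if i = n then 1 else i + 1)) (y i)) \<ge> 0)"

definition n_monotone ::
  "('a::real_vector \<Rightarrow> 'b::real_vector \<Rightarrow> real) \<Rightarrow> enat \<Rightarrow> ('a \<Rightarrow> 'b set) \<Rightarrow> bool" where
  "n_monotone c n T =
     (case n of enat m \<Rightarrow> fin_monotone c m T | \<infinity> \<Rightarrow> (\<forall>k\<ge>2. fin_monotone c k T))"

definition coupling ::
  "('a \<Rightarrow> 'b \<Rightarrow> real) \<Rightarrow> 'a \<times> 'b \<Rightarrow> ereal" where
  "coupling c = (\<lambda>(x, y). ereal (c x y))"

definition coupling_on_graph ::
  "('a \<Rightarrow> 'b \<Rightarrow> real) \<Rightarrow> ('a \<Rightarrow> 'b set) \<Rightarrow> 'a \<times> 'b \<Rightarrow> ereal" where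
  "coupling_on_graph c T z = (if z \<in> mgraph T then coupling c z else \<infinity>)"

text \<open>In \<open>ereal\<close> the infimum of the empty set is \<open>\<infinity>\<close>, as intended.
  The index \<open>0\<close> has no meaning and is never used.\<close>

definition fin_P ::
  "('a::real_vector \<Rightarrow> 'b::real_vector \<Rightarrow> real) \<Rightarrow> ('a \<Rightarrow> 'b set) \<Rightarrow> nat \<Rightarrow> 'a \<times> 'b \<Rightarrow> ereal" where
  "fin_P c T n = (\<lambda>(x, y).
     if n = 1 then coupling_on_graph c T (x, y)
     else if n = 2 then
       Inf {ereal (c x1 y + c (x - x1) y2) | x1 y2. x1 \<in> minverse T y \<and> y2 \<in> T x}
     else
       Inf {ereal (c (xs 1) y + (\<Sum>i=2..n-1. c (xs i - xs (i - 1)) (ys i))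
                     + c (x - xs (n - 1)) (ys n)) | xs ys.
            xs 1 \<in> minverse T y \<and> ys n \<in> T x \<and> (\<forall>i\<in>{2..n-1}. (xs i, ys i) \<in> mgraph T)})"

definition P_fun ::
  "('a::real_vector \<Rightarrow> 'b::real_vector \<Rightarrow> real) \<Rightarrow> ('a \<Rightarrow> 'b set) \<Rightarrow> enat \<Rightarrow> 'a \<times> 'b \<Rightarrow> ereal" where
  "P_fun c T n z = (case n of enat m \<Rightarrow> fin_P c T m z | \<infinity> \<Rightarrow> (INF m\<in>{1..}. fin_P c T m z))"

definition coincidence_set :: "('z \<Rightarrow> ereal) \<Rightarrow> ('z \<Rightarrow> ereal) \<Rightarrow> 'z set" where
  "coincidence_set f g = {z. f z = g z}"

definition proper_function :: "('z \<Rightarrow> ereal) \<Rightarrow> bool" where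
  "proper_function f \<longleftrightarrow> (\<exists>z. f z \<noteq> \<infinity>) \<and> (\<forall>z. f z \<noteq> -\<infinity>)"

end

theory Submission
  imports Defs
begin

text \<open>A tuple of points of the graph, traversed cyclically, has the \<^emph>\<open>cyclic sum\<close>
  \<open>\<Sum> c (x\<^sub>i - x\<^sub>i\<^sub>-\<^sub>1) (y\<^sub>i)\<close> with \<open>x\<^sub>0 = x\<^sub>n\<close>.  Reversing the order of the tuple turns this into the sum that
  defines \<open>n\<close>-monotonicity, so an operator is \<open>n\<close>-monotone iff all cyclic sums of length \<open>n\<close>
  are nonnegative.

  The expression minimised in the definition of \<open>P\<^sub>n (x, y)\<close> is a path that starts with the
  second component \<open>y\<close> and stops at the first component \<open>x\<close>.  Closing the path, that is, setting
  \<open>x\<^sub>n = x\<close> and \<open>y\<^sub>1 = y\<close>, replaces its first term \<open>c x\<^sub>1 y\<close> by \<open>c (x\<^sub>1 - x) y\<close>, so it lowers the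
  value by exactly \<open>c x y\<close>.  Hence \<open>P\<^sub>n (x, y)\<close> is \<open>c x y\<close> plus the infimum of the cyclic sums over
  all cycles in the graph with \<open>x\<^sub>n = x\<close> and \<open>y\<^sub>1 = y\<close> (\<open>fin_P_eq_Inf_cyclic_sum\<close>); this covers
  \<open>n = 1\<close>, \<open>n = 2\<close> and \<open>n \<ge> 3\<close> alike.  Every cycle occurs for some \<open>(x, y)\<close>, which gives the
  equivalence.  On the graph, the constant cycle at \<open>(x, y)\<close> has sum \<open>0\<close>, so there
  \<open>P\<^sub>n \<le> c\<close>; together with \<open>P\<^sub>n \<ge> c\<close> this gives equality on the graph and, as \<open>c\<close> is finite,
  properness.  The case \<open>n = \<infinity>\<close> follows by taking the infimum over the lengths.\<close>

definition cyclic_sum ::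
  "('a::real_vector \<Rightarrow> 'b::real_vector \<Rightarrow> real) \<Rightarrow> nat \<Rightarrow> (nat \<Rightarrow> 'a) \<Rightarrow> (nat \<Rightarrow> 'b) \<Rightarrow> real" where
  "cyclic_sum c n x y = (\<Sum>i=1..n. c (x i - x (if i = 1 then n else i - 1)) (y i))"

text \<open>The reversal \<open>i \<mapsto> n + 1 - i\<close> exchanges cyclic successors and predecessors.\<close>

lemma cyclic_sum_reverse:
  "cyclic_sum c n (\<lambda>i. x (n + 1 - i)) (\<lambda>i. y (n + 1 - i)) =
     (\<Sum>i=1..n. c (x i - x (if i = n then 1 else i + 1)) (y i))"
  unfolding cyclic_sum_def
  by (rule sum.reindex_bij_witness[of _ "\<lambda>i. n + 1 - i" "\<lambda>i. n + 1 - i"])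
     (auto simp: Suc_diff_le)

lemma fin_monotone_iff_cyclic_sum:
  "fin_monotone c n T \<longleftrightarrow>
     (\<forall>x y. (\<forall>i\<in>{1..n}. (x i, y i) \<in> mgraph T) \<longrightarrow> cyclic_sum c n x y \<ge> 0)"
    (is "_ \<longleftrightarrow> ?R")
proof
  assume mono: "fin_monotone c n T"
  show ?R
  proof (intro allI impI)
    fix x y
    assume graph: "\<forall>i\<in>{1..n}. (x i, y i) \<in> mgraph T"
    have "cyclic_sum c n x y =
        cyclic_sum c n (\<lambda>i. x (n + 1 - (n + 1 - i))) (\<lambda>i. y (n + 1 - (n + 1 - i)))"
      unfolding cyclic_sum_def by (intro sum.cong) auto
    also have "\<dots> = (\<Sum>i=1..n. c (x (n + 1 - i) - x (n + 1 - (if i = n then 1 else i + 1)))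
        (y (n + 1 - i)))"
      by (rule cyclic_sum_reverse)
    also have "\<dots> \<ge> 0"
    proof -
      have "\<forall>i\<in>{1..n}. (x (n + 1 - i), y (n + 1 - i)) \<in> mgraph T"
      proof
        fix i assume "i \<in> {1..n}"
        then show "(x (n + 1 - i), y (n + 1 - i)) \<in> mgraph T"
          by (intro graph[rule_format]) auto
      qed
      then show ?thesis
        by (rule mono[unfolded fin_monotone_def, THEN spec, THEN spec, THEN mp])
    qed
    finally show "cyclic_sum c n x y \<ge> 0" .
  qed
next
  assume R: ?R
  show "fin_monotone c n T"
    unfolding fin_monotone_def
  proof (intro allI impI)
    fix x y
    assume graph: "\<forall>i\<in>{1..n}. (x i, y i) \<in> mgraph T"
    show "(\<Sum>i=1..n. c (x i - x (if i = n then 1 else i + 1)) (y i)) \<ge> 0"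
      unfolding cyclic_sum_reverse[symmetric]
    proof (intro R[rule_format])
      fix i assume "i \<in> {1..n}"
      then show "(x (n + 1 - i), y (n + 1 - i)) \<in> mgraph T"
        by (intro graph[rule_format]) auto
    qed
  qed
qed

text \<open>Opening a cycle at its last point: only the first term changes, by bilinearity.\<close>

lemma path_value_eq_cyclic_sum:
  assumes "bilinear c" "n \<ge> 2"
  shows "c (xs 1) (ys 1) + (\<Sum>i=2..n-1. c (xs i - xs (i - 1)) (ys i))
           + c (xs n - xs (n - 1)) (ys n)
         = c (xs n) (ys 1) + cyclic_sum c n xs ys"
proof -
  have "{1..n} = insert 1 (insert n {2..n-1})"
    using assms(2) by auto
  then have "cyclic_sum c n xs ys = c (xs 1 - xs n) (ys 1)
      + (\<Sum>i=2..n-1. c (xs i - xs (i - 1)) (ys i)) + c (xs n - xs (n - 1)) (ys n)"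
    using assms(2) unfolding cyclic_sum_def by (auto intro!: sum.cong)
  then show ?thesis
    using bilinear_lsub[OF assms(1), of "xs 1" "xs n" "ys 1"] by simp
qed

text \<open>The separate formula for \<open>n = 2\<close> is the general one with an empty middle sum.\<close>

lemma fin_P_eq_Inf_path:
  assumes "n \<ge> 2"
  shows "fin_P c T n (x, y) =
    Inf {ereal (c (xs 1) y + (\<Sum>i=2..n-1. c (xs i - xs (i - 1)) (ys i))
                     + c (x - xs (n - 1)) (ys n)) | xs ys.
            xs 1 \<in> minverse T y \<and> ys n \<in> T x \<and> (\<forall>i\<in>{2..n-1}. (xs i, ys i) \<in> mgraph T)}"
proof (cases "n = 2")
  case True
  have "{ereal (c x1 y + c (x - x1) y2) | x1 y2. x1 \<in> minverse T y \<and> y2 \<in> T x} =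
    {ereal (c (xs (1::nat)) y + c (x - xs 1) (ys (2::nat))) | xs ys.
       xs 1 \<in> minverse T y \<and> ys 2 \<in> T x}" (is "?A = ?B")
  proof
    show "?A \<subseteq> ?B"
    proof
      fix r assume "r \<in> ?A"
      then obtain x1 y2 where "r = ereal (c x1 y + c (x - x1) y2)"
        "x1 \<in> minverse T y" "y2 \<in> T x" by blast
      then show "r \<in> ?B"
        by (intro CollectI exI[of _ "\<lambda>_. x1"] exI[of _ "\<lambda>_. y2"]) simp
    qed
  qed blast
  then show ?thesis
    using True by (simp add: fin_P_def)
qed (use assms in \<open>simp add: fin_P_def\<close>)

text \<open>The path formula leaves \<open>x\<^sub>n\<close> and \<open>y\<^sub>1\<close> free; overwriting them by \<open>x\<close> and \<open>y\<close> closes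
  the path to a cycle without changing its value.\<close>

lemma fin_P_eq_Inf_cyclic_sum:
  assumes "bilinear c" "n \<ge> 1"
  shows "fin_P c T n (x, y) =
    Inf {ereal (c x y + cyclic_sum c n xs ys) | xs ys.
           xs n = x \<and> ys 1 = y \<and> (\<forall>i\<in>{1..n}. (xs i, ys i) \<in> mgraph T)}"
proof (cases "n = 1")
  case True
  have zero: "cyclic_sum c 1 xs ys = 0" for xs ys
    using bilinear_lzero[OF assms(1)] by (simp add: cyclic_sum_def)
  have "{ereal (c x y + cyclic_sum c n xs ys) | xs ys.
      xs n = x \<and> ys 1 = y \<and> (\<forall>i\<in>{1..n}. (xs i, ys i) \<in> mgraph T)} =
      (if (x, y) \<in> mgraph T then {ereal (c x y)} else {})"
  proof (cases "(x, y) \<in> mgraph T")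
    case graph: True
    then show ?thesis
      using True zero by (auto intro!: exI[of _ "\<lambda>_. x"] exI[of _ "\<lambda>_. y"])
  qed (use True in auto)
  then show ?thesis
    using True by (simp add: fin_P_def coupling_on_graph_def coupling_def top_ereal_def)
next
  case False
  then have n: "n \<ge> 2"
    using assms(2) by simp
  have "{ereal (c (xs 1) y + (\<Sum>i=2..n-1. c (xs i - xs (i - 1)) (ys i))
                     + c (x - xs (n - 1)) (ys n)) | xs ys.
            xs 1 \<in> minverse T y \<and> ys n \<in> T x \<and> (\<forall>i\<in>{2..n-1}. (xs i, ys i) \<in> mgraph T)} =
        {ereal (c x y + cyclic_sum c n xs ys) | xs ys.
           xs n = x \<and> ys 1 = y \<and> (\<forall>i\<in>{1..n}. (xs i, ys i) \<in> mgraph T)}" (is "?A = ?B")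
  proof
    show "?A \<subseteq> ?B"
    proof
      fix r assume "r \<in> ?A"
      then obtain xs ys where r: "r = ereal (c (xs 1) y
            + (\<Sum>i=2..n-1. c (xs i - xs (i - 1)) (ys i)) + c (x - xs (n - 1)) (ys n))"
        and path: "xs 1 \<in> minverse T y" "ys n \<in> T x"
          "\<forall>i\<in>{2..n-1}. (xs i, ys i) \<in> mgraph T"
        by blast
      define xs' where "xs' = xs(n := x)"
      define ys' where "ys' = ys(1 := y)"
      have "(\<Sum>i=2..n-1. c (xs' i - xs' (i - 1)) (ys' i)) =
            (\<Sum>i=2..n-1. c (xs i - xs (i - 1)) (ys i))"
        by (intro sum.cong) (auto simp: xs'_def ys'_def)
      moreover have ends': "xs' n = x" "ys' 1 = y"
        and first: "xs' 1 = xs 1" and last: "xs' (n - 1) = xs (n - 1)" "ys' n = ys n"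
        using n by (auto simp: xs'_def ys'_def)
      ultimately have "r = ereal (c x y + cyclic_sum c n xs' ys')"
        using path_value_eq_cyclic_sum[OF assms(1) n, of xs' ys'] ends' first last
        by (simp add: r)
      moreover have "(xs' i, ys' i) \<in> mgraph T" if "i \<in> {1..n}" for i
      proof -
        consider "i = 1" | "i = n" | "i \<in> {2..n-1}"
          using \<open>i \<in> {1..n}\<close> by force
        then show ?thesis
          using path n by cases (auto simp: xs'_def ys'_def mgraph_def minverse_def)
      qed
      ultimately show "r \<in> ?B"
        using ends' by blast
    qed
    show "?B \<subseteq> ?A"
    proof
      fix r assume "r \<in> ?B"
      then obtain xs ys where r: "r = ereal (c x y + cyclic_sum c n xs ys)"
        and ends: "xs n = x" "ys 1 = y"
        and graph: "\<forall>i\<in>{1..n}. (xs i, ys i) \<in> mgraph T"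
        by blast
      have "r = ereal (c (xs 1) y + (\<Sum>i=2..n-1. c (xs i - xs (i - 1)) (ys i))
                     + c (x - xs (n - 1)) (ys n))"
        using path_value_eq_cyclic_sum[OF assms(1) n, of xs ys]
        unfolding r ends by simp
      moreover have "xs 1 \<in> minverse T y" "ys n \<in> T x"
        using graph[rule_format, of 1] graph[rule_format, of n] n ends
        by (auto simp: mgraph_def minverse_def)
      moreover have "\<forall>i\<in>{2..n-1}. (xs i, ys i) \<in> mgraph T"
        using graph by auto
      ultimately show "r \<in> ?A"
        by blast
    qed
  qed
  then show ?thesis
    by (simp only: fin_P_eq_Inf_path[OF n])
qed

lemma fin_monotone_iff_fin_P_ge:
  assumes "bilinear c" "n \<ge> 1"
  shows "fin_monotone c n T \<longleftrightarrow> (\<forall>z. coupling c z \<le> fin_P c T n z)"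
proof
  assume mono: "fin_monotone c n T"
  show "\<forall>z. coupling c z \<le> fin_P c T n z"
  proof
    fix z :: "'a \<times> 'b"
    obtain x y where z: "z = (x, y)" by (cases z)
    show "coupling c z \<le> fin_P c T n z"
      using mono unfolding fin_monotone_iff_cyclic_sum z fin_P_eq_Inf_cyclic_sum[OF assms]
      by (intro Inf_greatest) (auto simp: coupling_def)
  qed
next
  assume ge: "\<forall>z. coupling c z \<le> fin_P c T n z"
  show "fin_monotone c n T"
    unfolding fin_monotone_iff_cyclic_sum
  proof (intro allI impI)
    fix xs :: "nat \<Rightarrow> 'a" and ys :: "nat \<Rightarrow> 'b"
    assume "\<forall>i\<in>{1..n}. (xs i, ys i) \<in> mgraph T"
    then have "fin_P c T n (xs n, ys 1) \<le> ereal (c (xs n) (ys 1) + cyclic_sum c n xs ys)"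
      unfolding fin_P_eq_Inf_cyclic_sum[OF assms] by (intro Inf_lower) blast
    then have "coupling c (xs n, ys 1) \<le> ereal (c (xs n) (ys 1) + cyclic_sum c n xs ys)"
      using ge order_trans by blast
    then show "cyclic_sum c n xs ys \<ge> 0"
      by (simp add: coupling_def)
  qed
qed

lemma fin_P_le_coupling_on_mgraph:
  assumes "bilinear c" "n \<ge> 1" "z \<in> mgraph T"
  shows "fin_P c T n z \<le> coupling c z"
proof -
  obtain x y where z: "z = (x, y)" by (cases z)
  have "cyclic_sum c n (\<lambda>_. x) (\<lambda>_. y) = 0"
    using bilinear_lzero[OF assms(1)] by (simp add: cyclic_sum_def)
  then have "ereal (c x y) \<in> {ereal (c x y + cyclic_sum c n xs ys) | xs ys.
           xs n = x \<and> ys 1 = y \<and> (\<forall>i\<in>{1..n}. (xs i, ys i) \<in> mgraph T)}"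
    using assms(3) z by (intro CollectI exI[of _ "\<lambda>_. x"] exI[of _ "\<lambda>_. y"]) simp
  then show ?thesis
    unfolding z fin_P_eq_Inf_cyclic_sum[OF assms(1,2)] by (simp add: coupling_def Inf_lower)
qed

text \<open>For \<open>n = \<infinity>\<close> the infimum starts at length \<open>1\<close> but monotonicity at length \<open>2\<close>; this is
  harmless because \<open>P\<^sub>1\<close> is \<open>c\<close> on the graph and \<open>\<infinity>\<close> elsewhere, hence always at least \<open>c\<close>.\<close>

lemma n_monotone_iff_P_fun_ge:
  assumes "bilinear c" "n \<ge> 1"
  shows "n_monotone c n T \<longleftrightarrow> (\<forall>z. coupling c z \<le> P_fun c T n z)"
proof (cases n)
  case (enat m)
  then have "m \<ge> 1"
    using assms(2) by (simp add: one_enat_def)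
  then show ?thesis
    using fin_monotone_iff_fin_P_ge[OF assms(1)] enat by (simp add: n_monotone_def P_fun_def)
next
  case infinity
  have one: "coupling c z \<le> fin_P c T 1 z" for z
    by (cases z) (simp add: fin_P_def coupling_on_graph_def)
  have "n_monotone c n T \<longleftrightarrow> (\<forall>k\<ge>2. \<forall>z. coupling c z \<le> fin_P c T k z)"
    using infinity fin_monotone_iff_fin_P_ge[OF assms(1)] by (simp add: n_monotone_def)
  also have "\<dots> \<longleftrightarrow> (\<forall>k\<ge>1. \<forall>z. coupling c z \<le> fin_P c T k z)"
  proof -
    have "k = 1 \<or> k \<ge> 2" if "k \<ge> 1" for k :: nat
      using that by linarith
    then show ?thesis
      using one by (metis one_le_numeral order_trans)
  qed
  also have "\<dots> \<longleftrightarrow> (\<forall>z. coupling c z \<le> P_fun c T n z)"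
    using infinity by (auto simp: P_fun_def le_INF_iff)
  finally show ?thesis .
qed

lemma P_fun_le_coupling_on_mgraph:
  assumes "bilinear c" "n \<ge> 1" "z \<in> mgraph T"
  shows "P_fun c T n z \<le> coupling c z"
proof (cases n)
  case (enat m)
  then show ?thesis
    using assms fin_P_le_coupling_on_mgraph by (simp add: P_fun_def one_enat_def)
next
  case infinity
  have "(INF m\<in>{1..}. fin_P c T m z) \<le> coupling c z"
    using fin_P_le_coupling_on_mgraph[OF assms(1) order_refl assms(3)]
    by (rule INF_lower2[rotated]) simp
  then show ?thesis
    using infinity by (simp add: P_fun_def)
qed

theorem theorem6:
  fixes c :: "'a::real_vector \<Rightarrow> 'b::real_vector \<Rightarrow> real"
    and n :: enat
    and T :: "'a \<Rightarrow> 'b set"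
  assumes "bilinear c"
    and "n \<ge> 1"
  shows "(n_monotone c n T \<longleftrightarrow> (\<forall>z. P_fun c T n z \<ge> coupling c z)) \<and>
         (n_monotone c n T \<longrightarrow>
            mgraph T \<subseteq> coincidence_set (P_fun c T n) (coupling c) \<and>
            (mgraph T \<noteq> {} \<longrightarrow> proper_function (P_fun c T n)))"
proof (intro conjI impI)
  show iff: "n_monotone c n T \<longleftrightarrow> (\<forall>z. P_fun c T n z \<ge> coupling c z)"
    by (rule n_monotone_iff_P_fun_ge[OF assms])
  assume "n_monotone c n T"
  then have ge: "coupling c z \<le> P_fun c T n z" for z
    using iff by blast
  have eq: "P_fun c T n z = coupling c z" if "z \<in> mgraph T" for z
    using P_fun_le_coupling_on_mgraph[OF assms that] ge by (rule antisym)
  then show "mgraph T \<subseteq> coincidence_set (P_fun c T n) (coupling c)"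
    by (auto simp: coincidence_set_def)
  have finite_coupling: "coupling c z \<noteq> \<infinity>" "coupling c z \<noteq> -\<infinity>" for z
    by (cases z; simp add: coupling_def)+
  assume "mgraph T \<noteq> {}"
  then obtain z0 where "z0 \<in> mgraph T" by blast
  then have "P_fun c T n z0 \<noteq> \<infinity>"
    using eq finite_coupling(1) by simp
  moreover have "P_fun c T n z \<noteq> -\<infinity>" for z
    using ge[of z] finite_coupling(2)[of z] by auto
  ultimately show "proper_function (P_fun c T n)"
    unfolding proper_function_def by blast
qed

end
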